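(* Let $\mathfrak{A}$ be a finite-dimensional $C^*$-algebra and let $T \colon \mathfrak{A} \to \mathfrak{A}$ be a unital linear map (i.e. $T\mathbf{1} = \mathbf{1}$) whose spectrum $\mathrm{Sp}(T)$ is contained in the unit circle $\mathbb{T} = \{\lambda \in \mathbb{C} : |\lambda| = 1\}$. Then: (i) If $T$ is positive, then so is $T^{-1}$, and $T$ is a Jordan automorphism. (ii) If $T$ is a Schwarz operator, then $T$ is a $C^*$-automorphism. (iii) In particular, if $T$ is $n$-positive for some integer $n \ge 2$, then $T$ is a $C^*$-automorphism.
   Context: Let $\mathfrak{A}$ be a $C^*$-algebra, $\mathfrak{A}_+$ its positive cone and $\mathfrak{A}_h$ its self-adjoint part. A linear operator $T$ on $\mathfrak{A}$ is positive if $T(\mathfrak{A}_+) \subseteq \mathfrak{A}_+$. A bounded linear operator $T$ on $\mathfrak{A}$ is a Schwarz operator if $T(x)^* T(x) \le \|T\| \, T(x^*x)$ for all $x \in \mathfrak{A}$. $T$ is $n$-positive if its canonical (entrywise) extension $T^{(n)}$ to $M_n(\mathfrak{A})$ is positive. The Jordan product on $\mathfrak{A}_h$ is $x \circ y = \frac12(xy+yx)$. A bounded linear operator $T \colon \mathfrak{A}\to\mathfrak{A}$ is a Jordan homomorphism if $T(x\circ y) = (Tx)\circ(Ty)$ for all $x,y \in \mathfrak{A}_h$, and a Jordan automorphism if it is a bijective Jordan homomorphism. A $C^*$-automorphism is a bijective $*$-homomorphism $\mathfrak{A}\to\mathfrak{A}$. *)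

theory Defs
  imports "HOL-Analysis.Analysis" "Jordan_Normal_Form.Matrix"
begin

text \<open>
  Unital complex \<open>C\<^sup>*\<close>-algebras. Going through \<^class>\<open>monoid_mult\<close> rather than
  \<^class>\<open>real_normed_algebra_1\<close> keeps the zero algebra, where \<open>1 = 0\<close>, as an instance.
\<close>

class cstar_algebra = real_normed_algebra + banach + monoid_mult +
  fixes scaleC :: "complex \<Rightarrow> 'a \<Rightarrow> 'a" (infixr "*\<^sub>C" 75)
    and star :: "'a \<Rightarrow> 'a"
  assumes scaleC_add_right: "a *\<^sub>C (x + y) = a *\<^sub>C x + a *\<^sub>C y"
    and scaleC_add_left: "(a + b) *\<^sub>C x = a *\<^sub>C x + b *\<^sub>C x"
    and scaleC_scaleC: "a *\<^sub>C b *\<^sub>C x = (a * b) *\<^sub>C x"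
    and scaleC_one: "1 *\<^sub>C x = x"
    and scaleR_scaleC: "r *\<^sub>R x = complex_of_real r *\<^sub>C x"
    and mult_scaleC_left: "(a *\<^sub>C x) * y = a *\<^sub>C (x * y)"
    and mult_scaleC_right: "x * (a *\<^sub>C y) = a *\<^sub>C (x * y)"
    and norm_scaleC: "norm (a *\<^sub>C x) = cmod a * norm x"
    and star_star: "star (star x) = x"
    and star_add: "star (x + y) = star x + star y"
    and star_scaleC: "star (a *\<^sub>C x) = cnj a *\<^sub>C star x"
    and star_mult: "star (x * y) = star y * star x"
    and cstar_identity: "norm (star x * x) = (norm x)\<^sup>2"

lemma vector_space_scaleC: "vector_space (scaleC :: complex \<Rightarrow> 'a::cstar_algebra \<Rightarrow> 'a)"
  by unfold_locales (simp_all add: scaleC_add_right scaleC_add_left scaleC_scaleC scaleC_one)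

definition finite_dimensional :: "'a::cstar_algebra itself \<Rightarrow> bool" where
  "finite_dimensional _ \<longleftrightarrow> (\<exists>B :: 'a set. finite B \<and> module.span scaleC B = UNIV)"

definition clinear :: "('a::cstar_algebra \<Rightarrow> 'a) \<Rightarrow> bool" where
  "clinear T \<longleftrightarrow> Vector_Spaces.linear scaleC scaleC T"

definition bounded_clinear :: "('a::cstar_algebra \<Rightarrow> 'a) \<Rightarrow> bool" where
  "bounded_clinear T \<longleftrightarrow> clinear T \<and> (\<exists>K. \<forall>x. norm (T x) \<le> K * norm x)"

definition op_spectrum :: "('a::cstar_algebra \<Rightarrow> 'a) \<Rightarrow> complex set" where
  "op_spectrum T = {z. \<not> bij (\<lambda>x. z *\<^sub>C x - T x)}"

definition self_adjoint :: "'a::cstar_algebra set" where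
  "self_adjoint = {x. star x = x}"

text \<open>
  \<open>{y\<^sup>* y}\<close> is used as the definition of positivity both for the algebra and for
  \<open>M\<^sub>n\<close> over it, where it does not require constructing the \<open>C\<^sup>*\<close>-norm.
\<close>

definition positive_cone :: "'a::cstar_algebra set" where
  "positive_cone = {star y * y | y. True}"

definition cstar_le :: "'a::cstar_algebra \<Rightarrow> 'a \<Rightarrow> bool" (infix "\<le>\<^sub>+" 50) where
  "x \<le>\<^sub>+ y \<longleftrightarrow> y - x \<in> positive_cone"

definition positive_operator :: "('a::cstar_algebra \<Rightarrow> 'a) \<Rightarrow> bool" where
  "positive_operator T \<longleftrightarrow> clinear T \<and> T ` positive_cone \<subseteq> positive_cone"

definition schwarz_operator :: "('a::cstar_algebra \<Rightarrow> 'a) \<Rightarrow> bool" where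
  "schwarz_operator T \<longleftrightarrow>
     bounded_clinear T \<and> (\<forall>x. star (T x) * T x \<le>\<^sub>+ onorm T *\<^sub>R T (star x * x))"

text \<open>\<open>M\<^sub>n(A)\<close> is \<^term>\<open>carrier_mat n n\<close>; its involution is the conjugate transpose.\<close>

definition mat_star :: "'a::cstar_algebra mat \<Rightarrow> 'a mat" where
  "mat_star X = map_mat star (transpose_mat X)"

definition mat_positive_cone :: "nat \<Rightarrow> 'a::cstar_algebra mat set" where
  "mat_positive_cone n = {mat_star Y * Y | Y. Y \<in> carrier_mat n n}"

definition n_positive :: "nat \<Rightarrow> ('a::cstar_algebra \<Rightarrow> 'a) \<Rightarrow> bool" where
  "n_positive n T \<longleftrightarrow> clinear T \<and> map_mat T ` mat_positive_cone n \<subseteq> mat_positive_cone n"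

definition jordan_prod :: "'a::cstar_algebra \<Rightarrow> 'a \<Rightarrow> 'a" (infixl "\<circ>\<^sub>J" 70) where
  "x \<circ>\<^sub>J y = (1/2) *\<^sub>R (x * y + y * x)"

text \<open>
  The Jordan product is a product on the self-adjoint part, so the defining identity
  presupposes that \<open>T\<close> maps the self-adjoint part into itself; this is made explicit.
\<close>

definition jordan_hom :: "('a::cstar_algebra \<Rightarrow> 'a) \<Rightarrow> bool" where
  "jordan_hom T \<longleftrightarrow> bounded_clinear T \<and> T ` self_adjoint \<subseteq> self_adjoint \<and>
     (\<forall>x\<in>self_adjoint. \<forall>y\<in>self_adjoint. T (x \<circ>\<^sub>J y) = T x \<circ>\<^sub>J T y)"

definition jordan_automorphism :: "('a::cstar_algebra \<Rightarrow> 'a) \<Rightarrow> bool" where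
  "jordan_automorphism T \<longleftrightarrow> jordan_hom T \<and> bij T"

definition star_hom :: "('a::cstar_algebra \<Rightarrow> 'a) \<Rightarrow> bool" where
  "star_hom T \<longleftrightarrow> clinear T \<and> (\<forall>x y. T (x * y) = T x * T y) \<and> (\<forall>x. T (star x) = star (T x))"

definition cstar_automorphism :: "('a::cstar_algebra \<Rightarrow> 'a) \<Rightarrow> bool" where
  "cstar_automorphism T \<longleftrightarrow> star_hom T \<and> bij T"

end

theory Submission
  imports Defs "HOL-Computational_Algebra.Fundamental_Theorem_Algebra"
begin

text \<open>
  A positive unital \<open>T\<close> has bounded powers, so having unimodular spectrum it is diagonalisable with
  unimodular eigenvalues. Hence every \<open>y\<close> is recurrent, \<open>T\<^sup>n y \<rightarrow> y\<close> along a subsequence; if \<open>T y \<ge> 0\<close>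
  this exhibits \<open>y\<close> as a limit of positive elements, so \<open>T\<^sup>-\<^sup>1\<close> is positive. A unital order automorphism
  preserves projections and their orthogonality, and the spectral theorem turns this into
  \<open>T (x\<^sup>2) = (T x)\<^sup>2\<close> for self-adjoint \<open>x\<close>. Under a Schwarz inequality with any constant,
  \<open>x = x p\<close> forces \<open>T x = T x T p\<close> for projections \<open>p\<close>; applying this to \<open>y p\<close> and \<open>y (1 - p)\<close> gives
  \<open>T (y p) = T y T p\<close>, and projections span. For \<open>n \<ge> 2\<close>, \<open>n\<close>-positivity implies the Schwarz inequality.
\<close>

section \<open>Complex linear maps and diagonalisation\<close>

interpretation cvec: vector_space "scaleC :: complex \<Rightarrow> 'a::cstar_algebra \<Rightarrow> 'a"
  by (rule vector_space_scaleC)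

lemma clinear_iff:
  "clinear T \<longleftrightarrow> (\<forall>x y. T (x + y) = T x + T y) \<and> (\<forall>c x. T (c *\<^sub>C x) = c *\<^sub>C T x)"
  unfolding clinear_def Vector_Spaces.linear_iff
  using vector_space_scaleC by auto

context
  fixes T :: "'a::cstar_algebra \<Rightarrow> 'a"
  assumes T: "clinear T"
begin

lemma clinear_add: "T (x + y) = T x + T y"
  and clinear_scaleC: "T (c *\<^sub>C x) = c *\<^sub>C T x"
  using T by (auto simp: clinear_iff)

lemma clinear_0: "T 0 = 0"
  using clinear_scaleC[of 0 0] by simp

lemma clinear_scaleR: "T (r *\<^sub>R x) = r *\<^sub>R T x"
  by (simp add: scaleR_scaleC clinear_scaleC)

lemma clinear_minus: "T (- x) = - T x"
  using clinear_scaleR[of "-1" x] by simp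

lemma clinear_diff: "T (x - y) = T x - T y"
  using clinear_add[of x "- y"] by (simp add: clinear_minus)

lemma clinear_sum: "T (sum f A) = (\<Sum>i\<in>A. T (f i))"
  by (induction A rule: infinite_finite_induct) (simp_all add: clinear_0 clinear_add)

lemmas clinear_simps = clinear_add clinear_diff clinear_scaleR clinear_scaleC clinear_sum

lemma clinear_funpow: "clinear (T ^^ n)"
  by (induction n) (auto simp: clinear_iff clinear_add clinear_scaleC)

end

section \<open>Eigenvector decomposition by means of an annihilating polynomial\<close>

definition poly_op :: "('a::cstar_algebra \<Rightarrow> 'a) \<Rightarrow> complex poly \<Rightarrow> 'a \<Rightarrow> 'a" where
  "poly_op L p y = (\<Sum>i\<le>degree p. coeff p i *\<^sub>C (L ^^ i) y)"

lemma poly_op_upto: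
  assumes "degree p \<le> N"
  shows "poly_op L p y = (\<Sum>i\<le>N. coeff p i *\<^sub>C (L ^^ i) y)"
  unfolding poly_op_def
  by (rule sum.mono_neutral_left) (use assms in \<open>auto simp: coeff_eq_0\<close>)

text \<open>Lets a root \<open>c\<close> be split off: if \<open>(X - c) q\<close> annihilates
  \<open>y\<close>, then \<open>q\<close>, of lower degree, annihilates
  \<open>L y - c y\<close>.\<close>

lemma poly_op_linear_factor:
  assumes "clinear L"
  shows "poly_op L ([:-c, 1:] * q) y = poly_op L q (L y - c *\<^sub>C y)"
proof -
  let ?N = "Suc (degree q)"
  have deg: "degree ([:-c, 1:] * q) \<le> ?N"
    by (rule order_trans[OF degree_mult_le]) simp
  have co: "coeff ([:-c, 1:] * q) i = (case i of 0 \<Rightarrow> 0 | Suc j \<Rightarrow> coeff q j) - c * coeff q i" for i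
    by (simp add: coeff_pCons)
  have "poly_op L ([:-c, 1:] * q) y
      = (\<Sum>i\<le>?N. (case i of 0 \<Rightarrow> 0 | Suc j \<Rightarrow> coeff q j) *\<^sub>C (L ^^ i) y)
        - (\<Sum>i\<le>?N. (c * coeff q i) *\<^sub>C (L ^^ i) y)"
    unfolding poly_op_upto[OF deg] co cvec.scale_left_diff_distrib sum_subtractf ..
  also have "(\<Sum>i\<le>?N. (case i of 0 \<Rightarrow> 0 | Suc j \<Rightarrow> coeff q j) *\<^sub>C (L ^^ i) y)
      = (\<Sum>i\<le>degree q. coeff q i *\<^sub>C (L ^^ i) (L y))"
    unfolding sum.atMost_Suc_shift by (simp add: funpow_swap1)
  also have "(\<Sum>i\<le>?N. (c * coeff q i) *\<^sub>C (L ^^ i) y)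
      = (\<Sum>i\<le>degree q. coeff q i *\<^sub>C (c *\<^sub>C (L ^^ i) y))"
    by (simp add: coeff_eq_0 mult.commute)
  finally show ?thesis
    unfolding poly_op_def
    by (simp add: clinear_diff[OF clinear_funpow[OF assms]]
        clinear_scaleC[OF clinear_funpow[OF assms]] cvec.scale_right_diff_distrib sum_subtractf)
qed

text \<open>The first \<open>card B + 1\<close> iterates of \<open>y\<close> outnumber a spanning
  set, so they satisfy a linear relation, whose coefficients form \<open>p\<close>.\<close>

lemma annihilating_poly:
  fixes y :: "'a::cstar_algebra"
  assumes "finite_dimensional TYPE('a)"
  obtains p where "p \<noteq> 0" "poly_op L p y = 0"
proof -
  obtain B :: "'a set" where B: "finite B" "cvec.span B = UNIV"
    using assms unfolding finite_dimensional_def by auto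
  let ?N = "card B" and ?g = "\<lambda>i. (L ^^ i) y"
  have "\<exists>u. (\<exists>i\<le>?N. u i \<noteq> 0) \<and> (\<Sum>i\<le>?N. u i *\<^sub>C ?g i) = 0"
  \<comment> \<open>Dependence of a set sees the iterates only if they are distinct; two equal
    iterates give the relation with coefficients 1 and -1.\<close>
  proof (cases "inj_on ?g {..?N}")
    case True
    have "cvec.dependent (?g ` {..?N})"
      using cvec.independent_span_bound[OF B(1), of "?g ` {..?N}"] B(2) card_image[OF True]
      by auto
    then obtain u where "\<exists>v\<in>?g ` {..?N}. u v \<noteq> 0" "(\<Sum>v\<in>?g ` {..?N}. u v *\<^sub>C v) = 0"
      by (auto simp: cvec.dependent_finite)
    then show ?thesis
      by (intro exI[of _ "u \<circ> ?g"]) (auto simp: sum.reindex[OF True])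
  next
    case False
    then obtain i j where ij: "i \<le> ?N" "j \<le> ?N" "?g i = ?g j" "i \<noteq> j"
      unfolding inj_on_def by auto
    have "(\<Sum>k\<le>?N. ((if k = i then 1 else 0) - (if k = j then 1 else 0)) *\<^sub>C ?g k) = 0"
      unfolding cvec.scale_left_diff_distrib sum_subtractf
      using ij by (simp add: if_distrib[where f = "\<lambda>c. c *\<^sub>C _"] cong: if_cong)
    then show ?thesis
      by (intro exI[of _ "\<lambda>k. (if k = i then 1 else 0) - (if k = j then 1 else 0)"])
        (use ij in auto)
  qed
  then obtain u i where u: "i \<le> ?N" "u i \<noteq> 0" "(\<Sum>i\<le>?N. u i *\<^sub>C ?g i) = 0" by blast
  define p where "p = (\<Sum>i\<le>?N. monom (u i) i)"
  have co: "coeff p k = (if k \<le> ?N then u k else 0)" for k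
    by (simp add: p_def coeff_sum)
  have "degree p \<le> ?N" by (rule degree_le) (simp add: co)
  then have "poly_op L p y = 0" using u(3) by (simp add: poly_op_upto co)
  moreover have "p \<noteq> 0" using co[of i] u by auto
  ultimately show thesis using that by blast
qed

text \<open>Indexing by the eigenvalue puts one summand at each \<open>c\<close>. A summand may be
  0, so members of \<open>S\<close> need not be eigenvalues.\<close>

definition eigen_sum :: "('a::cstar_algebra \<Rightarrow> 'a) \<Rightarrow> complex set \<Rightarrow> (complex \<Rightarrow> 'a) \<Rightarrow> 'a \<Rightarrow> bool" where
  "eigen_sum L S v y \<longleftrightarrow> finite S \<and> (\<forall>c\<in>S. L (v c) = c *\<^sub>C v c) \<and> y = (\<Sum>c\<in>S. v c)"

text \<open>On eigenvectors for \<open>d\<close> other than \<open>c\<close>, \<open>L - c\<close>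
  is inverted by dividing by \<open>d - c\<close>. Removing these preimages from \<open>y\<close>
  leaves \<open>x\<close> with \<open>(L - c) x\<close> in the kernel of \<open>L - c\<close>;
  semisimplicity (no Jordan block of size two) makes \<open>x\<close> itself lie in that
  kernel.\<close>

lemma eigen_sum_step:
  assumes L: "clinear L"
    and semisimple: "\<And>c y. L (L y - c *\<^sub>C y) = c *\<^sub>C (L y - c *\<^sub>C y) \<Longrightarrow> L y = c *\<^sub>C y"
    and dec: "eigen_sum L S v (L y - c *\<^sub>C y)"
  shows "\<exists>S v. eigen_sum L S v y"
proof -
  define w where "w d = (1 / (d - c)) *\<^sub>C v d" for d
  define x where "x = y - (\<Sum>d\<in>S - {c}. w d)"
  note lin = clinear_add[OF L] clinear_scaleC[OF L] clinear_diff[OF L] clinear_sum[OF L] clinear_0[OF L]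
  have fin: "finite S" and eig: "\<And>d. d \<in> S \<Longrightarrow> L (v d) = d *\<^sub>C v d"
    and sum: "L y - c *\<^sub>C y = sum v S"
    using dec by (auto simp: eigen_sum_def)
  have Lw: "L (w d) = d *\<^sub>C w d" if "d \<in> S" for d
    using eig[OF that] by (simp add: w_def lin mult.commute)
  have w: "L (w d) - c *\<^sub>C w d = v d" if "d \<in> S - {c}" for d
  proof -
    have "L (w d) - c *\<^sub>C w d = (d - c) *\<^sub>C w d"
      using Lw that by (simp add: cvec.scale_left_diff_distrib)
    also have "\<dots> = v d" using that by (simp add: w_def)
    finally show ?thesis .
  qed
  have "L x - c *\<^sub>C x = (L y - c *\<^sub>C y) - (\<Sum>d\<in>S - {c}. L (w d) - c *\<^sub>C w d)"
    by (simp add: x_def lin cvec.scale_right_diff_distrib cvec.scale_sum_right sum_subtractf)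
  also have "\<dots> = sum v S - sum v (S - {c})" using sum w by simp
  also have "\<dots> = (if c \<in> S then v c else 0)" using fin by (simp add: sum.remove)
  finally have res: "L x - c *\<^sub>C x = (if c \<in> S then v c else 0)" .
  have "L x = c *\<^sub>C x"
    by (rule semisimple) (use res eig in \<open>simp add: lin\<close>)
  moreover have "(\<Sum>d\<in>S - {c}. if d = c then x else w d) = sum w (S - {c})"
    by (rule sum.cong) auto
  ultimately have "eigen_sum L (insert c (S - {c})) (\<lambda>d. if d = c then x else w d) y"
    using fin Lw unfolding eigen_sum_def by (subst sum.insert) (auto simp: x_def)
  then show ?thesis by blast
qed

text \<open>Induction on the degree of a polynomial annihilating \<open>y\<close>: for a complex
  root \<open>c\<close>, the quotient by \<open>X - c\<close> annihilates \<open>L y - c y\<close>,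
  and \<open>eigen_sum_step\<close> lifts the decomposition to \<open>y\<close>.\<close>

lemma diagonalisation:
  fixes L :: "'a::cstar_algebra \<Rightarrow> 'a"
  assumes fd: "finite_dimensional TYPE('a)" and L: "clinear L"
    and semisimple: "\<And>c y. L (L y - c *\<^sub>C y) = c *\<^sub>C (L y - c *\<^sub>C y) \<Longrightarrow> L y = c *\<^sub>C y"
  obtains S v where "eigen_sum L S v y"
proof -
  have "\<exists>S v. eigen_sum L S v y" if "p \<noteq> 0" "poly_op L p y = 0" for p y
    using that
  proof (induction "degree p" arbitrary: p y)
    case 0
    then have "y = 0"
      using leading_coeff_neq_0[of p] by (simp add: poly_op_def)
    then show ?case by (intro exI[of _ "{}"]) (simp add: eigen_sum_def)
  next
    case (Suc n)
    then have "\<not> constant (poly p)" by (simp add: constant_degree)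
    then obtain c where "poly p c = 0" using fundamental_theorem_of_algebra by blast
    then obtain q where q: "p = [:-c, 1:] * q" unfolding poly_eq_0_iff_dvd by (auto elim: dvdE)
    have "q \<noteq> 0" using Suc.prems(1) q by auto
    then have "degree p = Suc (degree q)" unfolding q by (subst degree_mult_eq) auto
    then have "n = degree q" using Suc.hyps by simp
    moreover have "poly_op L q (L y - c *\<^sub>C y) = 0"
      using Suc.prems(2) unfolding q poly_op_linear_factor[OF L] .
    ultimately have "\<exists>S v. eigen_sum L S v (L y - c *\<^sub>C y)"
      using Suc.hyps(1)[OF _ \<open>q \<noteq> 0\<close>] by blast
    then show ?case using eigen_sum_step[OF L semisimple] by blast
  qed
  then show thesis using that annihilating_poly[OF fd] by metis
qed


section \<open>The spectral theorem\<close>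

lemma star_0 [simp]: "star (0 :: 'a::cstar_algebra) = 0"
  using star_add[of "0 :: 'a" 0] by simp

lemma star_scaleR [simp]: "star (r *\<^sub>R x) = r *\<^sub>R star x"
  by (simp add: scaleR_scaleC star_scaleC)

lemma star_minus [simp]: "star (- x :: 'a::cstar_algebra) = - star x"
  using star_scaleR[of "-1" x] by simp

lemma star_diff [simp]: "star (x - y :: 'a::cstar_algebra) = star x - star y"
  using star_add[of x "- y"] by simp

lemma star_sum: "star (sum f A :: 'a::cstar_algebra) = (\<Sum>i\<in>A. star (f i))"
  by (induction A rule: infinite_finite_induct) (simp_all add: star_add)

lemma star_1 [simp]: "star (1 :: 'a::cstar_algebra) = 1"
  using star_mult[of "star 1 :: 'a" 1] by (simp add: star_star)

lemma norm_star [simp]: "norm (star (x :: 'a::cstar_algebra)) = norm x"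
proof -
  have *: "norm y \<le> norm (star y)" for y :: 'a
  proof (cases "y = 0")
    case False
    have "(norm y)\<^sup>2 \<le> norm (star y) * norm y"
      using norm_mult_ineq[of "star y" y] by (simp add: cstar_identity)
    then show ?thesis using False by (simp add: power2_eq_square)
  qed simp
  from *[of x] *[of "star x"] show ?thesis by (simp add: star_star)
qed

lemma star_self_mult_eq_0_iff [simp]: "star x * x = 0 \<longleftrightarrow> (x :: 'a::cstar_algebra) = 0"
  using cstar_identity[of x] by auto

lemma star_self_mult_self_adjoint [simp]: "star (star x * x) = star x * (x :: 'a::cstar_algebra)"
  by (simp add: star_mult star_star)

section \<open>Functional calculus of a finite resolution of the identity\<close>

definition spectral_calc :: "'i set \<Rightarrow> ('i \<Rightarrow> 'a::cstar_algebra) \<Rightarrow> ('i \<Rightarrow> real) \<Rightarrow> 'a" where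
  "spectral_calc S p f = (\<Sum>i\<in>S. f i *\<^sub>R p i)"

text \<open>Non-vanishing of the \<open>p i\<close> makes each coefficient \<open>f i\<close>
  recoverable from \<open>calc f\<close> and bounded by its norm.\<close>

locale resolution =
  fixes S :: "'i set" and p :: "'i \<Rightarrow> 'a::cstar_algebra"
  assumes finite: "finite S"
    and star_p: "i \<in> S \<Longrightarrow> star (p i) = p i"
    and p_mult: "i \<in> S \<Longrightarrow> j \<in> S \<Longrightarrow> p i * p j = (if i = j then p i else 0)"
    and p_nonzero: "i \<in> S \<Longrightarrow> p i \<noteq> 0"
    and sum_p: "sum p S = 1"
begin

abbreviation "calc \<equiv> spectral_calc S p"

lemma calc_cong: "(\<And>i. i \<in> S \<Longrightarrow> f i = g i) \<Longrightarrow> calc f = calc g"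
  by (simp add: spectral_calc_def)

lemma calc_add: "calc f + calc g = calc (\<lambda>i. f i + g i)"
  by (simp add: spectral_calc_def scaleR_left_distrib sum.distrib)

lemma calc_diff: "calc f - calc g = calc (\<lambda>i. f i - g i)"
  by (simp add: spectral_calc_def scaleR_left_diff_distrib sum_subtractf)

lemma calc_minus: "- calc f = calc (\<lambda>i. - f i)"
  by (simp add: spectral_calc_def sum_negf)

lemma calc_scaleR: "c *\<^sub>R calc f = calc (\<lambda>i. c * f i)"
  by (simp add: spectral_calc_def scaleR_sum_right)

lemma calc_const: "calc (\<lambda>i. c) = c *\<^sub>R 1"
  by (simp add: spectral_calc_def sum_p flip: scaleR_sum_right)

lemma star_calc: "star (calc f) = calc f"
  by (simp add: spectral_calc_def star_sum star_p)

lemma calc_mult_p: "j \<in> S \<Longrightarrow> calc f * p j = f j *\<^sub>R p j"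
  by (simp add: spectral_calc_def sum_distrib_right p_mult finite
      if_distrib[where f = "\<lambda>x. _ *\<^sub>R x"] cong: if_cong)

lemma calc_mult: "calc f * calc g = calc (\<lambda>i. f i * g i)"
proof -
  have "calc f * calc g = (\<Sum>j\<in>S. g j *\<^sub>R (calc f * p j))"
    by (simp add: spectral_calc_def[of S p g] sum_distrib_left)
  also have "\<dots> = calc (\<lambda>i. f i * g i)"
    by (simp add: calc_mult_p spectral_calc_def[of S p "\<lambda>i. f i * g i"] mult.commute)
  finally show ?thesis .
qed

lemma norm_calc_ge:
  assumes "i \<in> S"
  shows "\<bar>f i\<bar> \<le> norm (calc f)"
proof -
  have "\<bar>f i\<bar> * norm (p i) \<le> norm (calc f) * norm (p i)"
    using norm_mult_ineq[of "calc f" "p i"] assms by (simp add: calc_mult_p)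
  then show ?thesis using p_nonzero[OF assms] by simp
qed

lemma calc_eq_iff: "calc f = calc g \<longleftrightarrow> (\<forall>i\<in>S. f i = g i)"
  using norm_calc_ge[of _ "\<lambda>i. f i - g i"] by (auto simp flip: calc_diff intro: calc_cong)

text \<open>
  The crude bound by \<open>\<Sum>\<parallel>p i\<parallel>\<close> is sharpened by repeated squaring through the \<open>C\<^sup>*\<close>-identity.
\<close>

lemma norm_calc_le_1:
  assumes "\<And>i. i \<in> S \<Longrightarrow> \<bar>f i\<bar> \<le> 1"
  shows "norm (calc f) \<le> 1"
proof (rule ccontr)
  let ?K = "\<Sum>i\<in>S. norm (p i)"
  have bound: "norm (calc f) ^ 2 ^ n \<le> ?K" if "\<And>i. i \<in> S \<Longrightarrow> \<bar>f i\<bar> \<le> 1" for n f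
    using that
  proof (induction n arbitrary: f)
    case 0
    have "norm (calc f) \<le> (\<Sum>i\<in>S. norm (f i *\<^sub>R p i))"
      unfolding spectral_calc_def by (rule norm_sum)
    also have "\<dots> \<le> ?K"
      by (rule sum_mono) (use 0 in \<open>simp add: mult_left_le_one_le\<close>)
    finally show ?case by simp
  next
    case (Suc n)
    have "norm (calc f) ^ 2 ^ Suc n = norm (calc (\<lambda>i. f i * f i)) ^ 2 ^ n"
      using cstar_identity[of "calc f"] by (simp add: star_calc calc_mult power_mult)
    also have "\<dots> \<le> ?K"
      by (rule Suc.IH) (metis Suc.prems abs_ge_zero abs_mult mult_le_one)
    finally show ?case .
  qed
  assume "\<not> norm (calc f) \<le> 1"
  then obtain n where n: "?K < norm (calc f) ^ n"
    using real_arch_pow by (metis not_le)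
  also have "\<dots> \<le> norm (calc f) ^ 2 ^ n"
    using \<open>\<not> norm (calc f) \<le> 1\<close> by (intro power_increasing) (auto intro: less_imp_le less_exp)
  finally show False using bound[of f n] assms by simp
qed

lemma norm_calc_le:
  assumes "\<And>i. i \<in> S \<Longrightarrow> \<bar>f i\<bar> \<le> c" "0 \<le> c"
  shows "norm (calc f) \<le> c"
proof (cases "c = 0")
  case True
  then have "calc f = 0" using assms by (simp add: spectral_calc_def)
  then show ?thesis using True by simp
next
  case False
  then have c: "0 < c" using assms(2) by simp
  have "norm ((1 / c) *\<^sub>R calc f) \<le> 1"
    unfolding calc_scaleR
    by (rule norm_calc_le_1) (use assms(1) c in \<open>simp add: abs_mult\<close>)
  then show ?thesis using c by simp
qed

end

text \<open>
  Left multiplication by a self-adjoint \<open>x\<close> is diagonalisable; the eigencomponents of \<open>1\<close>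
  are then automatically mutually orthogonal projections.
\<close>

theorem spectral_theorem:
  fixes x :: "'a::cstar_algebra"
  assumes fd: "finite_dimensional TYPE('a)" and sa: "star x = x"
  obtains S :: "complex set" and p f where "resolution S p" "x = spectral_calc S p f"
proof -
  \<comment> \<open>Evaluating \<open>star z * (x * z)\<close> with \<open>x\<close> acting to
    either side gives \<open>c\<close> and its conjugate times \<open>star z * z\<close>.\<close>
  have real: "c \<in> \<real>" if "x * z = c *\<^sub>C z" "z \<noteq> 0" for c z
  proof -
    have "star z * (x * z) = star (x * z) * z" by (simp add: star_mult sa mult.assoc)
    then have "c *\<^sub>C (star z * z) = cnj c *\<^sub>C (star z * z)"
      by (simp add: that(1) star_scaleC mult_scaleC_left mult_scaleC_right)
    then have "c = cnj c" using that(2) by simp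
    then show ?thesis by (simp add: Reals_cnj_iff)
  qed
  \<comment> \<open>For real \<open>c\<close>, \<open>star z * z\<close> equals
    \<open>star y * (x * z - c z)\<close>, which is 0 since \<open>z\<close> is a
    \<open>c\<close>-eigenvector.\<close>
  have semisimple: "x * y = c *\<^sub>C y"
    if eig: "x * (x * y - c *\<^sub>C y) = c *\<^sub>C (x * y - c *\<^sub>C y)" for c y
  proof (rule ccontr)
    define z where "z = x * y - c *\<^sub>C y"
    assume "x * y \<noteq> c *\<^sub>C y"
    then have "z \<noteq> 0" by (simp add: z_def)
    moreover have xz: "x * z = c *\<^sub>C z" using eig by (simp add: z_def)
    ultimately have "cnj c = c" using real by (simp add: Reals_cnj_iff)
    then have "star z * z = star y * (x * z - c *\<^sub>C z)"
      by (simp add: z_def star_mult star_scaleC sa left_diff_distrib right_diff_distrib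
          mult_scaleC_left mult_scaleC_right mult.assoc)
    then show False using xz \<open>z \<noteq> 0\<close> by simp
  qed
  have "clinear ((*) x)"
    by (simp add: clinear_iff distrib_left mult_scaleC_right)
  then obtain S p where "eigen_sum ((*) x) S p 1"
    using diagonalisation[OF fd _ semisimple] by blast
  then have fin: "finite S" and xp: "\<And>c. c \<in> S \<Longrightarrow> x * p c = c *\<^sub>C p c" and sum1: "sum p S = 1"
    by (auto simp: eigen_sum_def)
  define S' where "S' = {c\<in>S. p c \<noteq> 0}"
  have S': "finite S'" "\<And>c. c \<in> S' \<Longrightarrow> c \<in> S \<and> p c \<noteq> 0"
    using fin by (auto simp: S'_def)
  have "sum p S' = sum p S"
    unfolding S'_def by (rule sum.mono_neutral_left) (use fin in auto)
  then have sum2: "sum p S' = 1" by (simp add: sum1)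
  have c_real: "c \<in> \<real>" if "c \<in> S'" for c using real xp S'(2) that by blast
  have orth: "star (p d) * p c = 0" if "c \<in> S'" "d \<in> S'" "c \<noteq> d" for c d
  proof -
    have "star (p d) * (x * p c) = star (x * p d) * p c"
      by (simp add: star_mult sa mult.assoc)
    then have "c *\<^sub>C (star (p d) * p c) = d *\<^sub>C (star (p d) * p c)"
      using that c_real[of d] xp S'(2)
      by (simp add: star_scaleC mult_scaleC_left mult_scaleC_right Reals_cnj_iff)
    then show ?thesis using that(3) by simp
  qed
  \<comment> \<open>Multiplying \<open>p c\<close> on the left by the adjoint of the unit
    \<open>sum p S'\<close> leaves only its own term, so \<open>p c\<close> is self-adjoint and
    idempotent.\<close>
  have p_pp: "p c = star (p c) * p c" if c: "c \<in> S'" for c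
  proof -
    have "p c = star (sum p S') * p c" by (simp add: sum2)
    also have "\<dots> = (\<Sum>d\<in>S'. if d = c then star (p c) * p c else 0)"
      unfolding star_sum sum_distrib_right by (rule sum.cong) (use orth c in auto)
    also have "\<dots> = star (p c) * p c" using c S'(1) by simp
    finally show ?thesis .
  qed
  have p_star: "star (p c) = p c" if "c \<in> S'" for c
    using p_pp[OF that] star_self_mult_self_adjoint by metis
  have "resolution S' p"
  proof
    show "p c * p d = (if c = d then p c else 0)" if "c \<in> S'" "d \<in> S'" for c d
      using orth[of d c] p_pp[of c] p_star[of c] that by auto
  qed (use S' sum2 p_star in auto)
  moreover have "x = spectral_calc S' p Re"
  proof -
    have "x = x * sum p S'" by (simp add: sum2)
    also have "\<dots> = (\<Sum>c\<in>S'. Re c *\<^sub>R p c)"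
      unfolding sum_distrib_left
      by (rule sum.cong) (use xp S'(2) c_real in \<open>auto simp: scaleR_scaleC\<close>)
    finally show ?thesis by (simp add: spectral_calc_def)
  qed
  ultimately show thesis using that by blast
qed


section \<open>The positive cone\<close>

text \<open>For self-adjoint \<open>x\<close> the bound confines the spectrum to
  \<open>[0, 2 t]\<close>. Unlike the form \<open>star y * y\<close>, it is visibly stable under
  sums.\<close>

definition norm_positive :: "'a::cstar_algebra \<Rightarrow> bool" where
  "norm_positive x \<longleftrightarrow> star x = x \<and> (\<exists>t. norm (t *\<^sub>R 1 - x) \<le> t)"

lemma norm_positive_add:
  assumes "norm_positive x" "norm_positive y"
  shows "norm_positive (x + y)"
proof -
  obtain s t where "norm (s *\<^sub>R 1 - x) \<le> s" "norm (t *\<^sub>R 1 - y) \<le> t"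
    using assms by (auto simp: norm_positive_def)
  then have "norm ((s *\<^sub>R 1 - x) + (t *\<^sub>R 1 - y)) \<le> s + t"
    by (rule norm_triangle_mono)
  then have "norm ((s + t) *\<^sub>R 1 - (x + y)) \<le> s + t"
    by (simp add: scaleR_left_distrib algebra_simps)
  then show ?thesis using assms by (auto simp: norm_positive_def star_add)
qed

context resolution
begin

lemma norm_positive_calc_iff: "norm_positive (calc f) \<longleftrightarrow> (\<forall>i\<in>S. 0 \<le> f i)"
proof
  assume "norm_positive (calc f)"
  then obtain t where t: "norm (t *\<^sub>R 1 - calc f) \<le> t"
    by (auto simp: norm_positive_def)
  have "\<bar>t - f i\<bar> \<le> t" if "i \<in> S" for i
    using norm_calc_ge[OF that, of "\<lambda>i. t - f i"] t
    by (simp flip: calc_diff calc_const)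
  then show "\<forall>i\<in>S. 0 \<le> f i" by force
next
  assume f: "\<forall>i\<in>S. 0 \<le> f i"
  let ?t = "norm (calc f)"
  have "norm (?t *\<^sub>R 1 - calc f) \<le> ?t"
    unfolding calc_const[symmetric] calc_diff
    by (rule norm_calc_le) (use f norm_calc_ge[of _ f] in force)+
  then show "norm_positive (calc f)"
    by (auto simp: norm_positive_def star_calc)
qed

lemma calc_in_positive_cone:
  assumes "\<And>i. i \<in> S \<Longrightarrow> 0 \<le> f i"
  shows "calc f \<in> positive_cone"
proof -
  have "calc f = star (calc (\<lambda>i. sqrt (f i))) * calc (\<lambda>i. sqrt (f i))"
    unfolding star_calc calc_mult by (rule calc_cong) (simp add: assms)
  then show ?thesis by (auto simp: positive_cone_def)
qed

end

section \<open>Elementary properties of the cone\<close>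

lemma positive_cone_0: "0 \<in> positive_cone"
  and positive_cone_1: "1 \<in> positive_cone"
  and star_self_mult_in_positive_cone: "star x * x \<in> positive_cone"
  unfolding positive_cone_def by (force intro: exI[of _ 0], force intro: exI[of _ 1], blast)

lemma positive_cone_self_adjoint: "x \<in> positive_cone \<Longrightarrow> star x = x"
  by (auto simp: positive_cone_def)

lemma positive_cone_conj:
  assumes "x \<in> positive_cone"
  shows "star y * x * y \<in> positive_cone"
proof -
  obtain z where "x = star z * z" using assms by (auto simp: positive_cone_def)
  then have "star y * x * y = star (z * y) * (z * y)" by (simp add: star_mult mult.assoc)
  then show ?thesis by (auto simp: positive_cone_def)
qed

lemma positive_cone_scaleR:
  assumes "x \<in> positive_cone" "0 \<le> c"
  shows "c *\<^sub>R x \<in> positive_cone"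
proof -
  have "c *\<^sub>R x = star (sqrt c *\<^sub>R 1) * x * (sqrt c *\<^sub>R 1)" using assms(2) by simp
  then show ?thesis using positive_cone_conj[OF assms(1)] by metis
qed

context
  assumes fd: "finite_dimensional TYPE('a::cstar_algebra)"
begin

lemma norm_positive_square:
  fixes a :: 'a
  assumes "star a = a"
  shows "norm_positive (a * a)"
proof -
  obtain S :: "complex set" and p f where "resolution S p" and a: "a = spectral_calc S p f"
    using spectral_theorem[OF fd assms] .
  then interpret resolution S p by simp
  show ?thesis unfolding a calc_mult norm_positive_calc_iff by simp
qed

text \<open>
  With \<open>z = a + \<i>b\<close> one has \<open>z z\<^sup>* = 2(a\<^sup>2 + b\<^sup>2) - z\<^sup>* z\<close>, so \<open>z z\<^sup>*\<close> is positive if \<open>- z\<^sup>* z\<close> is;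
  but \<open>z z\<^sup>*\<close> and \<open>z\<^sup>* z\<close> have the same nonzero spectrum.
\<close>

lemma star_self_mult_not_negative_projection:
  fixes z q :: 'a
  assumes zz: "star z * z = - q" and q: "star q = q" "q * q = q"
  shows "q = 0"
proof -
  \<comment> \<open>\<open>a\<close> and \<open>b\<close> are twice the real and imaginary parts of
    \<open>z\<close>.\<close>
  define a where "a = z + star z"
  define b where "b = \<i> *\<^sub>C (star z - z)"
  define w where "w = z * star z"
  have sa: "star a = a"
    by (simp add: a_def star_add star_star add.commute)
  have sb: "star b = b"
    by (simp add: b_def star_scaleC star_star cvec.scale_right_diff_distrib)
  have "a * a + b * b = 2 *\<^sub>R (w + star z * z)"
    by (simp add: a_def b_def w_def mult_scaleC_left mult_scaleC_right algebra_simps scaleR_2)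
  then have "a * a + b * b = 2 *\<^sub>R (w - q)" by (simp add: zz)
  moreover have "norm_positive (a * a + b * b)"
    using norm_positive_add norm_positive_square[OF sa] norm_positive_square[OF sb] by blast
  moreover have q_pos: "norm_positive q" using norm_positive_square[OF q(1)] q(2) by simp
  ultimately have "norm_positive (2 *\<^sub>R (w - q) + q + q)"
    by (simp add: norm_positive_add)
  then have w2: "norm_positive (2 *\<^sub>R w)"
    by (simp add: scaleR_2 algebra_simps)
  have "star (z - z * q) * (z - z * q) = star z * z - star z * z * q - q * (star z * z) + q * (star z * z) * q"
    by (simp add: star_mult q(1) algebra_simps)
  also have "\<dots> = 0" by (simp add: zz q(2))
  finally have zq: "z * q = z" unfolding star_self_mult_eq_0_iff by simp
  \<comment> \<open>This relation confines the spectral values of \<open>w\<close> to -1 and 0;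
    positivity of \<open>2 w\<close> leaves 0 alone.\<close>
  have "w * w = z * (star z * z) * star z" by (simp add: w_def mult.assoc)
  also have "\<dots> = - w" by (simp add: zz zq w_def)
  finally have ww: "w * w = - w" .
  have "star w = w" by (simp add: w_def star_mult star_star)
  then obtain S :: "complex set" and p f where "resolution S p" and w: "w = spectral_calc S p f"
    using spectral_theorem[OF fd] by blast
  then interpret resolution S p by simp
  have "f i * f i = - f i" if "i \<in> S" for i
    using ww that unfolding w calc_mult calc_minus calc_eq_iff by simp
  moreover have "0 \<le> f i" if "i \<in> S" for i
    using w2 that unfolding w calc_scaleR norm_positive_calc_iff by simp
  ultimately have "f i = 0" if "i \<in> S" for i
    using that by (metis add.inverse_inverse less_eq_real_def mult_nonneg_nonneg neg_le_0_iff_le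
        order_antisym)
  then have "w = 0" unfolding w by (simp add: spectral_calc_def)
  then have "z = 0" using star_self_mult_eq_0_iff[of "star z"] by (simp add: w_def star_star)
      (metis star_0 star_star)
  then show ?thesis using zz by simp
qed

text \<open>A negative spectral value \<open>f i\<close> is impossible: cutting \<open>y\<close>
  down by \<open>p i\<close> and rescaling yields \<open>z\<close> with
  \<open>star z * z = - p i\<close>, so the preceding lemma forces \<open>p i = 0\<close>.\<close>

lemma norm_positive_star_self_mult:
  fixes y :: 'a
  shows "norm_positive (star y * y)"
proof -
  obtain S :: "complex set" and p f where "resolution S p" and x: "star y * y = spectral_calc S p f"
    using spectral_theorem[OF fd star_self_mult_self_adjoint] .
  then interpret resolution S p by simp
  have "0 \<le> f i" if i: "i \<in> S" for i
  proof (rule ccontr)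
    assume neg: "\<not> 0 \<le> f i"
    define z where "z = (1 / sqrt (- f i)) *\<^sub>R (y * p i)"
    have "star z * z = (1 / - f i) *\<^sub>R (p i * (star y * y * p i))"
      using neg i by (simp add: z_def star_mult star_p mult.assoc)
    also have "\<dots> = - p i"
      unfolding x calc_mult_p[OF i] using neg i by (simp add: p_mult)
    finally have "p i = 0"
      by (rule star_self_mult_not_negative_projection) (use i in \<open>simp_all add: star_p p_mult\<close>)
    then show False using p_nonzero[OF i] by simp
  qed
  then show ?thesis unfolding x norm_positive_calc_iff by simp
qed

text \<open>Transfers stability under sums to the cone. From norm positivity to the cone, a square
  root in the functional calculus serves.\<close>

lemma positive_cone_iff_norm_positive:
  fixes x :: 'a
  shows "x \<in> positive_cone \<longleftrightarrow> norm_positive x"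
proof
  assume "norm_positive x"
  then have "star x = x" by (simp add: norm_positive_def)
  then obtain S :: "complex set" and p f where "resolution S p" and x: "x = spectral_calc S p f"
    using spectral_theorem[OF fd] by blast
  then interpret resolution S p by simp
  show "x \<in> positive_cone"
    unfolding x
    by (rule calc_in_positive_cone) (use \<open>norm_positive x\<close> x in \<open>simp add: norm_positive_calc_iff\<close>)
qed (auto simp: positive_cone_def norm_positive_star_self_mult)

lemma positive_cone_calc_iff:
  fixes p :: "'i \<Rightarrow> 'a"
  assumes "resolution S p"
  shows "spectral_calc S p f \<in> positive_cone \<longleftrightarrow> (\<forall>i\<in>S. 0 \<le> f i)"
  using resolution.norm_positive_calc_iff[OF assms] positive_cone_iff_norm_positive by blast

lemma positive_cone_add:
  fixes x y :: 'a
  shows "x \<in> positive_cone \<Longrightarrow> y \<in> positive_cone \<Longrightarrow> x + y \<in> positive_cone"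
  by (simp add: positive_cone_iff_norm_positive norm_positive_add)

lemma positive_cone_sum:
  fixes f :: "'i \<Rightarrow> 'a"
  shows "(\<And>i. i \<in> A \<Longrightarrow> f i \<in> positive_cone) \<Longrightarrow> sum f A \<in> positive_cone"
  by (induction A rule: infinite_finite_induct) (simp_all add: positive_cone_0 positive_cone_add)

lemma positive_cone_antisym:
  fixes x :: 'a
  assumes "x \<in> positive_cone" "- x \<in> positive_cone"
  shows "x = 0"
proof -
  obtain S :: "complex set" and p f where res: "resolution S p" and x: "x = spectral_calc S p f"
    using spectral_theorem[OF fd positive_cone_self_adjoint[OF assms(1)]] .
  interpret resolution S p by (fact res)
  have "f i = 0" if "i \<in> S" for i
    using assms that unfolding x calc_minus positive_cone_calc_iff[OF res] by force
  then show ?thesis by (simp add: x spectral_calc_def)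
qed

text \<open>Order-unit description of the norm: both sides say that the spectral values lie in
  \<open>[-c, c]\<close>. It turns positivity into norm bounds.\<close>

lemma norm_le_iff_positive_cone:
  fixes x :: 'a
  assumes "star x = x" "0 \<le> c"
  shows "norm x \<le> c \<longleftrightarrow> c *\<^sub>R 1 - x \<in> positive_cone \<and> c *\<^sub>R 1 + x \<in> positive_cone"
proof -
  obtain S :: "complex set" and p f where res: "resolution S p" and x: "x = spectral_calc S p f"
    using spectral_theorem[OF fd assms(1)] .
  interpret resolution S p by (fact res)
  have "norm x \<le> c \<longleftrightarrow> (\<forall>i\<in>S. \<bar>f i\<bar> \<le> c)"
    unfolding x using norm_calc_ge[of _ f] norm_calc_le[of f c] assms(2) by fastforce
  also have "\<dots> \<longleftrightarrow> c *\<^sub>R 1 - x \<in> positive_cone \<and> c *\<^sub>R 1 + x \<in> positive_cone"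
    unfolding x calc_const[symmetric] calc_diff calc_add positive_cone_calc_iff[OF res]
    by (auto simp: abs_le_iff)
  finally show ?thesis .
qed

text \<open>Norm positivity passes to the limit because the single \<open>t = norm y + 1\<close>
  serves all approximants within distance 1.\<close>

lemma positive_cone_closed:
  fixes y :: 'a
  assumes approx: "\<And>e. 0 < e \<Longrightarrow> \<exists>x\<in>positive_cone. norm (x - y) < e"
  shows "y \<in> positive_cone"
proof -
  define t where "t = norm y + 1"
  have sa: "norm (star y - y) \<le> e" and near: "norm (t *\<^sub>R 1 - y) \<le> t + e" if "0 < e" for e
  proof -
    \<comment> \<open>Distance below 1 keeps \<open>norm x\<close> under \<open>t\<close>; distance
      below \<open>e / 2\<close> enters twice into \<open>star y - y\<close>.\<close>
    have "0 < min 1 (e / 2)" using that by simp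
    then obtain x where x: "x \<in> positive_cone" and xy: "norm (x - y) < min 1 (e / 2)"
      using approx by blast
    note sax = positive_cone_self_adjoint[OF x]
    have "norm (star (y - x)) = norm (x - y)" by (simp only: norm_star norm_minus_commute)
    then have "norm (star (y - x) + (x - y)) \<le> e / 2 + e / 2"
      using xy by (intro norm_triangle_mono) auto
    then show "norm (star y - y) \<le> e" by (simp add: sax)
    have "norm x \<le> t" using norm_triangle_ineq[of "x - y" y] xy by (simp add: t_def)
    moreover have "0 \<le> t" by (simp add: t_def)
    ultimately have "t *\<^sub>R 1 - x \<in> positive_cone"
      using norm_le_iff_positive_cone[OF sax] by blast
    moreover have "t *\<^sub>R 1 + (t *\<^sub>R 1 - (t *\<^sub>R 1 - x)) = t *\<^sub>R 1 + x" by simp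
    ultimately have "norm (t *\<^sub>R 1 - x) \<le> t"
      using norm_le_iff_positive_cone[of "t *\<^sub>R 1 - x" t] x sax \<open>0 \<le> t\<close>
        positive_cone_add[OF positive_cone_scaleR[OF positive_cone_1 \<open>0 \<le> t\<close>]]
      by simp
    then have "norm ((t *\<^sub>R 1 - x) + (x - y)) \<le> t + e"
      using xy that by (intro norm_triangle_mono) auto
    then show "norm (t *\<^sub>R 1 - y) \<le> t + e" by simp
  qed
  have "norm (star y - y) \<le> 0" by (rule field_le_epsilon) (use sa in simp)
  moreover have "norm (t *\<^sub>R 1 - y) \<le> t" by (rule field_le_epsilon) (use near in simp)
  ultimately show ?thesis
    unfolding positive_cone_iff_norm_positive norm_positive_def by auto
qed

end


section \<open>Recurrence of power-bounded operators with unimodular spectrum\<close>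

text \<open>By compactness of the circle all \<open>c ^ r k\<close> converge along one strictly
  increasing \<open>r\<close>. Consecutive terms come close, and dividing by the unimodular
  \<open>c ^ r k\<close> leaves the positive exponent \<open>r (Suc k) - r k\<close>.\<close>

lemma simultaneous_power_recurrence:
  fixes S :: "complex set"
  assumes "finite S" and unit: "\<And>c. c \<in> S \<Longrightarrow> cmod c = 1" and "0 < e"
  obtains n where "\<And>c. c \<in> S \<Longrightarrow> cmod (c ^ Suc n - 1) < e"
proof -
  have "\<exists>r. strict_mono r \<and> (\<forall>c\<in>S. convergent (\<lambda>k. c ^ r k))"
    using assms(1) unit
  proof (induction S)
    case empty
    show ?case by (intro exI[of _ id]) (simp add: strict_mono_def)
  next
    case (insert d S)
    then obtain r :: "nat \<Rightarrow> nat"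
      where r: "strict_mono r" "\<And>c. c \<in> S \<Longrightarrow> convergent (\<lambda>k. c ^ r k)" by auto
    have "d ^ r k \<in> sphere 0 1" for k
      using insert.prems by (simp add: norm_power)
    then obtain l s where s: "strict_mono s" "((\<lambda>k. d ^ r k) \<circ> s) \<longlonglongrightarrow> l"
      using seq_compactE[OF compact_imp_seq_compact[OF compact_sphere]] by metis
    have "convergent (\<lambda>k. c ^ r (s k))" if "c \<in> insert d S" for c
      using that s(2) convergent_subseq_convergent[OF r(2) s(1)]
      by (auto simp: o_def convergent_def)
    then show ?case
      using strict_mono_o[OF r(1) s(1)] by (intro exI[of _ "\<lambda>k. r (s k)"]) (simp add: o_def)
  qed
  then obtain r :: "nat \<Rightarrow> nat"
    where r: "strict_mono r" "\<And>c. c \<in> S \<Longrightarrow> convergent (\<lambda>k. c ^ r k)" by auto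
  have "\<forall>\<^sub>F k in sequentially. cmod (c ^ r (Suc k) - c ^ r k) < e" if "c \<in> S" for c
  proof -
    from r(2)[OF that] obtain l where l: "(\<lambda>k. c ^ r k) \<longlonglongrightarrow> l" by (auto simp: convergent_def)
    have "(\<lambda>k. c ^ r (Suc k) - c ^ r k) \<longlonglongrightarrow> l - l"
      by (intro tendsto_diff l LIMSEQ_Suc[OF l])
    then show ?thesis using \<open>0 < e\<close> by (simp add: tendsto_iff)
  qed
  then have "\<forall>\<^sub>F k in sequentially. \<forall>c\<in>S. cmod (c ^ r (Suc k) - c ^ r k) < e"
    using assms(1) by (simp add: eventually_ball_finite_distrib)
  then obtain k where k: "\<And>c. c \<in> S \<Longrightarrow> cmod (c ^ r (Suc k) - c ^ r k) < e"
    using eventually_happens'[OF sequentially_bot] by blast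
  obtain n where n: "r (Suc k) = r k + Suc n"
    using strict_monoD[OF r(1), of k "Suc k"] less_iff_Suc_add[of "r k"] by auto
  show thesis
  proof
    fix c assume c: "c \<in> S"
    have "c ^ r (Suc k) - c ^ r k = c ^ r k * (c ^ Suc n - 1)"
      by (simp add: n power_add algebra_simps)
    then show "cmod (c ^ Suc n - 1) < e"
      using k[OF c] unit[OF c] by (simp add: norm_mult norm_power)
  qed
qed

lemma eigenvalue_in_op_spectrum:
  assumes "clinear T" "T z = c *\<^sub>C z" "z \<noteq> 0"
  shows "c \<in> op_spectrum T"
proof -
  have "c *\<^sub>C z - T z = c *\<^sub>C 0 - T 0" by (simp add: assms(2) clinear_0[OF assms(1)])
  then have "\<not> inj (\<lambda>x. c *\<^sub>C x - T x)" using assms(3) injD by metis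
  then show ?thesis by (simp add: op_spectrum_def bij_def)
qed

lemma bij_if_0_notin_op_spectrum:
  assumes "0 \<notin> op_spectrum T"
  shows "bij T"
proof -
  have "bij (uminus \<circ> (\<lambda>x. - T x))"
    by (rule bij_comp) (use assms in \<open>simp_all add: op_spectrum_def bij_uminus\<close>)
  then show ?thesis by (simp add: o_def)
qed

text \<open>A Jordan block of size two at a unimodular eigenvalue makes the powers grow linearly.\<close>

lemma power_bounded_semisimple:
  assumes T: "clinear T" and sp: "op_spectrum T \<subseteq> {z. cmod z = 1}"
    and bounded: "\<And>n x. norm ((T ^^ n) x) \<le> K * norm x"
    and eig: "T (T y - c *\<^sub>C y) = c *\<^sub>C (T y - c *\<^sub>C y)"
  shows "T y = c *\<^sub>C y"
proof (rule ccontr)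
  define z where "z = T y - c *\<^sub>C y"
  assume "T y \<noteq> c *\<^sub>C y"
  then have z: "z \<noteq> 0" by (simp add: z_def)
  have Tz: "T z = c *\<^sub>C z" using eig by (simp add: z_def)
  have c: "cmod c = 1" using eigenvalue_in_op_spectrum[OF T Tz z] sp by auto
  have Ty: "T y = c *\<^sub>C y + z" by (simp add: z_def)
  \<comment> \<open>Binomial formula for \<open>c\<close> plus a nilpotent of square zero; starting
    at \<open>Suc n\<close> avoids the exponent \<open>n - 1\<close>.\<close>
  have pow: "(T ^^ Suc n) y = c ^ Suc n *\<^sub>C y + (of_nat (Suc n) * c ^ n) *\<^sub>C z" for n
  proof (induction n)
    case (Suc n)
    have "(T ^^ Suc (Suc n)) y = c ^ Suc n *\<^sub>C T y + (of_nat (Suc n) * c ^ n) *\<^sub>C T z"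
      using Suc.IH by (simp add: clinear_add[OF T] clinear_scaleC[OF T])
    also have "\<dots> = (c ^ Suc n * c) *\<^sub>C y + (c ^ Suc n + of_nat (Suc n) * c ^ n * c) *\<^sub>C z"
      by (simp only: Ty Tz cvec.scale_right_distrib cvec.scale_left_distrib cvec.scale_scale add.assoc)
    also have "c ^ Suc n + of_nat (Suc n) * c ^ n * c = of_nat (Suc (Suc n)) * c ^ Suc n"
      by (simp add: algebra_simps)
    finally show ?case by (simp add: mult.commute)
  qed (simp add: Ty)
  have growth: "real (Suc n) * norm z \<le> (K + 1) * norm y" for n
  proof -
    have "real (Suc n) * norm z = norm ((T ^^ Suc n) y - c ^ Suc n *\<^sub>C y)"
      unfolding pow by (simp add: norm_scaleC norm_mult norm_power c del: of_nat_Suc)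
    also have "\<dots> \<le> norm ((T ^^ Suc n) y) + norm (c ^ Suc n *\<^sub>C y)"
      by (rule norm_triangle_ineq4)
    also have "\<dots> \<le> (K + 1) * norm y"
      using bounded[of "Suc n" y] by (simp add: norm_scaleC norm_power norm_mult c algebra_simps)
    finally show ?thesis .
  qed
  obtain n where "(K + 1) * norm y / norm z < real n"
    using reals_Archimedean2 by blast
  then have "(K + 1) * norm y < real n * norm z"
    using z by (simp add: pos_divide_less_eq)
  moreover have "real n * norm z \<le> real (Suc n) * norm z"
    by (simp add: mult_right_mono)
  ultimately show False using growth[of n] by linarith
qed

text \<open>With \<open>y\<close> a sum of eigenvectors \<open>v c\<close>, the difference
  \<open>T^m y - y\<close> is the sum of the \<open>(c ^ m - 1) v c\<close>, and one
  \<open>m\<close> makes all relevant factors small.\<close>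

lemma power_bounded_recurrence:
  fixes T :: "'a::cstar_algebra \<Rightarrow> 'a"
  assumes fd: "finite_dimensional TYPE('a)"
    and T: "clinear T" and sp: "op_spectrum T \<subseteq> {z. cmod z = 1}"
    and bounded: "\<And>n x. norm ((T ^^ n) x) \<le> K * norm x"
    and "0 < e"
  obtains n where "norm ((T ^^ Suc n) y - y) < e"
proof -
  obtain S v where "eigen_sum T S v y"
    using diagonalisation[OF fd T power_bounded_semisimple[OF T sp bounded]] by blast
  then have fin: "finite S" and eig: "\<And>c. c \<in> S \<Longrightarrow> T (v c) = c *\<^sub>C v c" and y: "y = sum v S"
    by (auto simp: eigen_sum_def)
  define V where "V = (\<Sum>c\<in>S. norm (v c))"
  have V: "0 \<le> V" by (simp add: V_def sum_nonneg)
  \<comment> \<open>The added 1 keeps the denominator positive if all components vanish and makes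
    the final bound strict.\<close>
  define d where "d = e / (V + 1)"
  have d: "0 < d" using V \<open>0 < e\<close> by (simp add: d_def)
  \<comment> \<open>Only a nonzero \<open>v c\<close> certifies \<open>c\<close> as an eigenvalue,
    hence as unimodular.\<close>
  define S' where "S' = {c\<in>S. v c \<noteq> 0}"
  have "finite S'" using fin by (simp add: S'_def)
  moreover have "cmod c = 1" if "c \<in> S'" for c
    using eigenvalue_in_op_spectrum[OF T eig] that sp by (auto simp: S'_def)
  ultimately obtain n where n: "\<And>c. c \<in> S' \<Longrightarrow> cmod (c ^ Suc n - 1) < d"
    using simultaneous_power_recurrence[of S' d] d by metis
  have pow: "(T ^^ k) (v c) = c ^ k *\<^sub>C v c" if "c \<in> S" for k c
    by (induction k) (simp_all add: eig[OF that] clinear_scaleC[OF T] mult.commute)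
  have "(T ^^ Suc n) y - y = (\<Sum>c\<in>S. (c ^ Suc n - 1) *\<^sub>C v c)"
    unfolding y clinear_sum[OF clinear_funpow[OF T]] sum_subtractf[symmetric]
    by (rule sum.cong) (simp_all add: pow cvec.scale_left_diff_distrib del: funpow.simps power_Suc)
  also have "norm \<dots> \<le> (\<Sum>c\<in>S. d * norm (v c))"
  proof (rule sum_norm_le)
    fix c assume "c \<in> S"
    then show "norm ((c ^ Suc n - 1) *\<^sub>C v c) \<le> d * norm (v c)"
      using n[of c] unfolding S'_def by (cases "v c = 0") (simp_all add: norm_scaleC mult_right_mono less_imp_le del: power_Suc)
  qed
  also have "\<dots> = d * V" by (simp add: V_def sum_distrib_left)
  also have "\<dots> < e" using V \<open>0 < e\<close> by (simp add: d_def divide_less_eq)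
  finally show thesis by (rule that)
qed

section \<open>Positive unital operators\<close>

lemma self_adjoint_parts:
  fixes x :: "'a::cstar_algebra"
  obtains h k where "star h = h" "star k = k" "x = h + \<i> *\<^sub>C k" "norm h \<le> norm x" "norm k \<le> norm x"
proof
  let ?h = "(1 / 2) *\<^sub>R (x + star x)" and ?k = "(- \<i> / 2) *\<^sub>C (x - star x)"
  show "star ?h = ?h" by (simp add: star_add star_star add.commute)
  show "star ?k = ?k" by (simp add: star_scaleC star_star cvec.scale_right_diff_distrib)
  show "x = ?h + \<i> *\<^sub>C ?k"
  proof -
    have "?h + \<i> *\<^sub>C ?k = (1 / 2) *\<^sub>R (x + star x) + (1 / 2) *\<^sub>R (x - star x)"
      by (simp add: scaleR_scaleC)
    also have "\<dots> = (1 / 2) *\<^sub>R (2 *\<^sub>R x)"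
      unfolding scaleR_right_distrib[symmetric] scaleR_2 by simp
    also have "\<dots> = x" by simp
    finally show ?thesis by simp
  qed
  show "norm ?h \<le> norm x" using norm_triangle_ineq[of x "star x"] by simp
  show "norm ?k \<le> norm x" using norm_triangle_ineq4[of x "star x"] by (simp add: norm_scaleC)
qed

lemma star_preserving_if_self_adjoint_preserving:
  assumes T: "clinear T" and sa: "\<And>x. star x = x \<Longrightarrow> star (T x) = T x"
  shows "T (star x) = star (T x)"
proof -
  obtain h k where "star h = h" "star k = k" "x = h + \<i> *\<^sub>C k"
    using self_adjoint_parts .
  then show ?thesis
    by (simp add: star_add star_scaleC clinear_add[OF T] clinear_diff[OF T] clinear_scaleC[OF T] sa)
qed

lemma clinear_if_positive: "positive_operator T \<Longrightarrow> clinear T"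
  by (simp add: positive_operator_def)

lemma positive_operatorD: "positive_operator T \<Longrightarrow> x \<in> positive_cone \<Longrightarrow> T x \<in> positive_cone"
  by (auto simp: positive_operator_def)

lemma positive_operator_funpow:
  assumes "positive_operator T"
  shows "positive_operator (T ^^ n)"
proof -
  have "(T ^^ n) x \<in> positive_cone" if "x \<in> positive_cone" for x
    using that by (induction n) (simp_all add: positive_operatorD[OF assms])
  then show ?thesis
    using clinear_funpow[OF clinear_if_positive[OF assms]] by (auto simp: positive_operator_def)
qed

lemma funpow_fixpoint: "T x = x \<Longrightarrow> (T ^^ n) x = x"
  by (induction n) simp_all

lemma projection_compl:
  fixes p :: "'a::cstar_algebra"
  assumes "star p = p" "p * p = p"
  shows "star (1 - p) = 1 - p" "(1 - p) * (1 - p) = 1 - p"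
  using assms by (simp_all add: algebra_simps)

lemma projection_in_positive_cone:
  "star p = p \<Longrightarrow> p * p = p \<Longrightarrow> p \<in> positive_cone"
  using star_self_mult_in_positive_cone[of p] by simp

context
  assumes fd: "finite_dimensional TYPE('a::cstar_algebra)"
begin

text \<open>Compressing by \<open>r\<close> gives
  \<open>0 <= star r * d * r <= star r * q * r = 0\<close>; with \<open>d = star e * e\<close> this
  means \<open>e * r = 0\<close>.\<close>

lemma dominated_mult_eq_0:
  fixes d q r :: 'a
  assumes "d \<in> positive_cone" "q - d \<in> positive_cone" "q * r = 0"
  shows "d * r = 0"
proof -
  obtain e where e: "d = star e * e" using assms(1) by (auto simp: positive_cone_def)
  have "star r * (q - d) * r = star r * (q * r) - star r * d * r"
    by (simp add: algebra_simps)
  then have "- (star r * d * r) \<in> positive_cone"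
    using positive_cone_conj[OF assms(2), of r] assms(3) by simp
  then have "star r * d * r = 0"
    using positive_cone_antisym[OF fd] positive_cone_conj[OF assms(1)] by blast
  then have "star (e * r) * (e * r) = 0" by (simp add: e star_mult mult.assoc)
  then show ?thesis by (simp add: e mult.assoc)
qed

context
  fixes T :: "'a \<Rightarrow> 'a"
  assumes pos: "positive_operator T" and unital: "T 1 = 1"
begin

lemmas lin = clinear_simps[OF clinear_if_positive[OF pos]]

text \<open>A positive element is self-adjoint, and \<open>x\<close> differs from one by a multiple
  of the unit, which \<open>T\<close> fixes.\<close>

lemma positive_unital_star_self_adjoint:
  assumes "star x = x"
  shows "star (T x) = T x"
proof -
  have "norm x *\<^sub>R 1 - x \<in> positive_cone"
    using norm_le_iff_positive_cone[OF fd assms, of "norm x"] by simp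
  from positive_cone_self_adjoint[OF positive_operatorD[OF pos this]] show ?thesis
    by (simp add: lin unital)
qed

lemma positive_unital_star: "T (star x) = star (T x)"
  using star_preserving_if_self_adjoint_preserving[OF clinear_if_positive[OF pos]]
    positive_unital_star_self_adjoint by blast

lemma positive_unital_norm_self_adjoint:
  assumes "star x = x"
  shows "norm (T x) \<le> norm x"
proof -
  have "norm x *\<^sub>R 1 - x \<in> positive_cone" "norm x *\<^sub>R 1 + x \<in> positive_cone"
    using norm_le_iff_positive_cone[OF fd assms, of "norm x"] by simp_all
  from this[THEN positive_operatorD[OF pos]] show ?thesis
    using norm_le_iff_positive_cone[OF fd positive_unital_star_self_adjoint[OF assms], of "norm x"]
    by (simp add: lin unital)
qed

text \<open>The factor 2 counts real and imaginary part. The same constant holds for all positive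
  unital operators, hence for every power of \<open>T\<close>.\<close>

lemma positive_unital_norm: "norm (T x) \<le> 2 * norm x"
proof -
  obtain h k where hk: "star h = h" "star k = k" "x = h + \<i> *\<^sub>C k" "norm h \<le> norm x" "norm k \<le> norm x"
    using self_adjoint_parts .
  have "norm (T x) \<le> norm (T h) + norm (T k)"
    using norm_triangle_ineq[of "T h" "\<i> *\<^sub>C T k"] by (simp add: hk(3) lin norm_scaleC)
  also have "\<dots> \<le> 2 * norm x"
    using positive_unital_norm_self_adjoint[OF hk(1)] positive_unital_norm_self_adjoint[OF hk(2)] hk(4,5)
    by linarith
  finally show ?thesis .
qed

end

lemma positive_if_image_positive:
  fixes T :: "'a \<Rightarrow> 'a"
  assumes pos: "positive_operator T" and unital: "T 1 = 1"
    and sp: "op_spectrum T \<subseteq> {z. cmod z = 1}"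
    and Ty: "T y \<in> positive_cone"
  shows "y \<in> positive_cone"
proof (rule positive_cone_closed[OF fd])
  fix e :: real assume "0 < e"
  have bounded: "norm ((T ^^ n) x) \<le> 2 * norm x" for n x
    by (intro positive_unital_norm positive_operator_funpow pos funpow_fixpoint unital)
  obtain n where "norm ((T ^^ Suc n) y - y) < e"
    using power_bounded_recurrence[OF fd clinear_if_positive[OF pos] sp bounded \<open>0 < e\<close>] .
  \<comment> \<open>The exponent is at least 1: one \<open>T\<close> is spent on \<open>y\<close>,
    and the remaining power preserves the cone.\<close>
  moreover have "(T ^^ Suc n) y \<in> positive_cone"
    using positive_operatorD[OF positive_operator_funpow[OF pos] Ty] by (simp add: funpow_swap1)
  ultimately show "\<exists>x\<in>positive_cone. norm (x - y) < e" by blast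
qed

section \<open>Unital order automorphisms\<close>

context
  fixes T :: "'a \<Rightarrow> 'a"
  assumes pos: "positive_operator T" and unital: "T 1 = 1" and bij: "bij T"
    and reflects: "\<And>y. T y \<in> positive_cone \<Longrightarrow> y \<in> positive_cone"
begin

lemmas lin' = clinear_simps[OF clinear_if_positive[OF pos]]

text \<open>
  A projection \<open>p\<close> is characterised in the order interval \<open>[0, 1]\<close> by the absence of a nonzero
  \<open>d \<ge> 0\<close> below both \<open>p\<close> and \<open>1 - p\<close>; for \<open>a\<close> in the interval, \<open>a - a\<^sup>2\<close> is such an element.
\<close>

lemma order_automorphism_projection:
  assumes p: "star p = p" "p * p = p"
  shows "T p * T p = T p"
proof -
  define a where "a = T p"
  define c where "c = a - a * a"
  have a: "a \<in> positive_cone"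
    unfolding a_def by (intro positive_operatorD[OF pos] projection_in_positive_cone p)
  have a1: "1 - a \<in> positive_cone"
    using positive_operatorD[OF pos projection_in_positive_cone[OF projection_compl[OF p]]]
    by (simp add: lin' unital a_def)
  note sa = positive_cone_self_adjoint[OF a]
  obtain S :: "complex set" and u f where res: "resolution S u" and af: "a = spectral_calc S u f"
    using spectral_theorem[OF fd sa] .
  interpret resolution S u by (fact res)
  have one: "1 = spectral_calc S u (\<lambda>i. 1)" by (simp add: calc_const)
  have "\<forall>i\<in>S. 0 \<le> f i" using a unfolding af positive_cone_calc_iff[OF fd res] .
  moreover have "\<forall>i\<in>S. 0 \<le> 1 - f i"
    using a1 unfolding af one calc_diff positive_cone_calc_iff[OF fd res] .
  ultimately have "\<forall>i\<in>S. 0 \<le> f i - f i * f i"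
    using mult_left_le[of "f i" "f i" for i] by (metis diff_ge_0_iff_ge)
  then have c: "c \<in> positive_cone"
    unfolding c_def af calc_mult calc_diff positive_cone_calc_iff[OF fd res] .
  have ac: "a - c \<in> positive_cone"
    using star_self_mult_in_positive_cone[of a] by (simp add: c_def sa)
  have "star (1 - a) * (1 - a) = 1 - a - c" by (simp add: c_def sa algebra_simps)
  then have a1c: "1 - a - c \<in> positive_cone"
    using star_self_mult_in_positive_cone[of "1 - a"] by simp
  \<comment> \<open>Reflection of positivity carries the bounds \<open>c <= a\<close> and
    \<open>c <= 1 - a\<close> back to \<open>d <= p\<close> and \<open>d <= 1 - p\<close>, so the
    products of \<open>d\<close> with \<open>1 - p\<close> and \<open>p\<close> vanish.\<close>
  obtain d where d: "T d = c" using bij_is_surj[OF bij] by (metis surjD)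
  have "d \<in> positive_cone" by (rule reflects) (simp add: d c)
  moreover have "p - d \<in> positive_cone" by (rule reflects) (use ac in \<open>simp add: lin' d a_def\<close>)
  moreover have "1 - p - d \<in> positive_cone"
    by (rule reflects) (use a1c in \<open>simp add: lin' d a_def unital\<close>)
  moreover have "p * (1 - p) = 0" "(1 - p) * p = 0"
    by (simp_all add: right_diff_distrib left_diff_distrib p(2))
  ultimately have "d * (1 - p) = 0" "d * p = 0"
    using dominated_mult_eq_0 by blast+
  then have "d = 0" by (simp add: right_diff_distrib)
  then have "c = 0" using d clinear_0[OF clinear_if_positive[OF pos]] by simp
  then show ?thesis by (simp add: c_def a_def)
qed

text \<open>Orthogonality is an order statement: \<open>p i + p j\<close> is a projection, so
  \<open>T (p i) <= 1 - T (p j)\<close>, and the right side annihilates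
  \<open>T (p j)\<close>.\<close>

lemma order_automorphism_resolution:
  assumes "resolution S p"
  shows "resolution S (T \<circ> p)"
proof -
  interpret p: resolution S p by (fact assms)
  have sa: "star (T (p i)) = T (p i)" if "i \<in> S" for i
    using positive_unital_star_self_adjoint[OF pos unital p.star_p[OF that]] .
  have idem: "T (p i) * T (p i) = T (p i)" if "i \<in> S" for i
    by (rule order_automorphism_projection) (use that p.star_p p.p_mult in simp_all)
  have orth: "T (p i) * T (p j) = 0" if ij: "i \<in> S" "j \<in> S" "i \<noteq> j" for i j
  proof (rule dominated_mult_eq_0)
    show "T (p i) \<in> positive_cone"
      using projection_in_positive_cone[OF sa idem] ij by blast
    have "star (p i + p j) = p i + p j" "(p i + p j) * (p i + p j) = p i + p j"
      using ij p.p_mult by (simp_all add: star_add p.star_p distrib_left distrib_right)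
    from projection_in_positive_cone[OF projection_compl[OF this]]
    have "1 - (p i + p j) \<in> positive_cone" .
    from positive_operatorD[OF pos this] show "(1 - T (p j)) - T (p i) \<in> positive_cone"
      by (simp add: lin' unital algebra_simps)
    show "(1 - T (p j)) * T (p j) = 0" using idem ij by (simp add: algebra_simps)
  qed
  have nonzero: "T (p i) \<noteq> 0" if "i \<in> S" for i
    using p.p_nonzero[OF that] injD[OF bij_is_inj[OF bij], of "p i" 0]
      clinear_0[OF clinear_if_positive[OF pos]] by auto
  show ?thesis
  proof
    show "sum (T \<circ> p) S = 1" using p.sum_p unital lin'(5)[of p S] by simp
  qed (use p.finite sa idem orth nonzero in auto)
qed

text \<open>\<open>T\<close> carries the functional calculus of \<open>x\<close> to that of
  \<open>T x\<close> with the same coefficients, so squares correspond.\<close>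

lemma order_automorphism_square:
  assumes "star x = x"
  shows "T (x * x) = T x * T x"
proof -
  obtain S :: "complex set" and p f where res: "resolution S p" and x: "x = spectral_calc S p f"
    using spectral_theorem[OF fd assms] .
  interpret p: resolution S p by (fact res)
  interpret Tp: resolution S "T \<circ> p" by (rule order_automorphism_resolution[OF res])
  have "T (spectral_calc S p g) = spectral_calc S (T \<circ> p) g" for g
    by (simp add: spectral_calc_def lin')
  then show ?thesis by (simp add: x p.calc_mult Tp.calc_mult)
qed

lemma order_automorphism_jordan: "jordan_automorphism T"
proof -
  \<comment> \<open>Polarisation of the square identity.\<close>
  have "T (x * y + y * x) = T x * T y + T y * T x" if "star x = x" "star y = y" for x y
  proof -
    have "T ((x + y) * (x + y)) = T (x + y) * T (x + y)"
      by (rule order_automorphism_square) (simp add: star_add that)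
    then show ?thesis
      using order_automorphism_square[OF that(1)] order_automorphism_square[OF that(2)]
      by (simp add: lin' distrib_left distrib_right algebra_simps)
  qed
  then show ?thesis
    using clinear_if_positive[OF pos] positive_unital_norm[OF pos unital] bij
      positive_unital_star_self_adjoint[OF pos unital]
    unfolding jordan_automorphism_def jordan_hom_def bounded_clinear_def
    by (auto simp: self_adjoint_def jordan_prod_def lin'(3))
qed

lemma schwarz_mult_projection:
  assumes schwarz: "\<And>x. c *\<^sub>R T (star x * x) - star (T x) * T x \<in> positive_cone" and "0 \<le> c"
    and p: "star p = p" "p * p = p"
  shows "T (y * p) = T y * T p"
proof -
  text \<open>The Schwarz inequality makes \<open>T\<close> respect right supports.\<close>
  have support: "T (y * q) * (1 - T q) = 0" if q: "star q = q" "q * q = q" for q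
  proof -
    \<comment> \<open>From \<open>star (y q) * (y q) <= k q\<close> the Schwarz inequality yields
      \<open>star (T (y q)) * T (y q) <= c k T q\<close>, and \<open>1 - T q\<close> annihilates the
      right side.\<close>
    define k where "k = norm (star y * y)"
    have "k *\<^sub>R 1 - star y * y \<in> positive_cone"
      using norm_le_iff_positive_cone[OF fd, of "star y * y" k] by (simp add: k_def)
    from positive_cone_conj[OF this, of q]
    have "k *\<^sub>R q - star (y * q) * (y * q) \<in> positive_cone"
      by (simp add: star_mult q algebra_simps)
    from positive_cone_scaleR[OF positive_operatorD[OF pos this] \<open>0 \<le> c\<close>]
    have "(c * k) *\<^sub>R T q - c *\<^sub>R T (star (y * q) * (y * q)) \<in> positive_cone"
      by (simp add: lin' scaleR_right_diff_distrib)
    from positive_cone_add[OF fd this schwarz[of "y * q"]]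
    have "(c * k) *\<^sub>R T q - star (T (y * q)) * T (y * q) \<in> positive_cone" by simp
    moreover have "(c * k) *\<^sub>R T q * (1 - T q) = 0"
      using order_automorphism_projection[OF q] by (simp add: algebra_simps)
    ultimately have "star (T (y * q)) * T (y * q) * (1 - T q) = 0"
      using dominated_mult_eq_0[OF star_self_mult_in_positive_cone] by blast
    then have "star (T (y * q) * (1 - T q)) * (T (y * q) * (1 - T q)) = 0"
      by (simp add: star_mult mult.assoc)
    then show ?thesis by simp
  qed
  have "T (y * p) - T (y * p) * T p = 0"
    using support[OF p] by (simp only: right_diff_distrib mult_1_right)
  \<comment> \<open>For the projection \<open>1 - p\<close> the support identity reads
    \<open>T (y (1 - p)) * T p = 0\<close>.\<close>
  moreover have "T y * T p - T (y * p) * T p = 0"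
    using support[OF projection_compl[OF p]]
    by (simp add: lin' unital right_diff_distrib left_diff_distrib)
  ultimately show ?thesis by simp
qed

text \<open>Projections span the algebra, first over the self-adjoint part. The free constant
  \<open>c\<close> covers both \<open>onorm T\<close> and the constant 1 coming from
  \<open>n\<close>-positivity.\<close>

lemma schwarz_order_automorphism:
  assumes schwarz: "\<And>x. c *\<^sub>R T (star x * x) - star (T x) * T x \<in> positive_cone" and "0 \<le> c"
  shows "cstar_automorphism T"
proof -
  have sa: "T (y * x) = T y * T x" if x_sa: "star x = x" for x y
  proof -
    obtain S :: "complex set" and p f where res: "resolution S p" and x: "x = spectral_calc S p f"
      using spectral_theorem[OF fd x_sa] .
    interpret p: resolution S p by (fact res)
    have "T (y * p i) = T y * T (p i)" if "i \<in> S" for i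
      by (rule schwarz_mult_projection[OF assms]) (use that p.star_p p.p_mult in simp_all)
    then show ?thesis by (simp add: x spectral_calc_def sum_distrib_left lin')
  qed
  have "T (y * x) = T y * T x" for x y
  proof -
    obtain h k where "star h = h" "star k = k" "x = h + \<i> *\<^sub>C k"
      using self_adjoint_parts .
    then show ?thesis by (simp add: lin' distrib_left mult_scaleC_right sa)
  qed
  then show ?thesis
    using clinear_if_positive[OF pos] positive_unital_star[OF pos unital] bij
    by (simp add: cstar_automorphism_def star_hom_def)
qed

end

end

section \<open>Schwarz and \<open>n\<close>-positive operators\<close>

lemma bounded_linear_if_bounded_clinear:
  assumes "bounded_clinear T"
  shows "bounded_linear T"
proof -
  obtain K where T: "clinear T" and K: "\<And>x. norm (T x) \<le> K * norm x"
    using assms by (auto simp: bounded_clinear_def)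
  show ?thesis
    by (rule bounded_linear_intro[of _ K])
      (use K in \<open>simp_all add: clinear_add[OF T] clinear_scaleR[OF T] mult.commute\<close>)
qed

text \<open>Division by \<open>\<parallel>T\<parallel> \<ge> 1\<close>; in the zero algebra, \<open>\<parallel>T\<parallel> = 0\<close> but the claim is trivial.\<close>

lemma schwarz_positive:
  fixes T :: "'a::cstar_algebra \<Rightarrow> 'a"
  assumes fd: "finite_dimensional TYPE('a)" and schwarz: "schwarz_operator T" and unital: "T 1 = 1"
  shows "positive_operator T"
proof -
  have T: "clinear T" and bl: "bounded_linear T"
    and le: "\<And>x. onorm T *\<^sub>R T (star x * x) - star (T x) * T x \<in> positive_cone"
    using schwarz bounded_linear_if_bounded_clinear
    by (auto simp: schwarz_operator_def bounded_clinear_def cstar_le_def)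
  have "T (star x * x) \<in> positive_cone" for x
  proof (cases "(1 :: 'a) = 0")
    case True
    then have "T (star x * x) = 0" by (metis mult_1_right mult_zero_right)
    then show ?thesis by (simp add: positive_cone_0)
  next
    case False
    have "norm (1 :: 'a) \<le> onorm T * norm (1 :: 'a)"
      using onorm[OF bl, of 1] by (simp add: unital)
    then have *: "1 \<le> onorm T" using False by simp
    have "onorm T *\<^sub>R T (star x * x) \<in> positive_cone"
      using positive_cone_add[OF fd le star_self_mult_in_positive_cone, of x "T x"] by simp
    from positive_cone_scaleR[OF this, of "1 / onorm T"] * show ?thesis by simp
  qed
  then show ?thesis using T by (auto simp: positive_operator_def positive_cone_def)
qed

section \<open>Schwarz inequality from matrix positivity\<close>

lemma mat_star_mult_index:
  fixes Y :: "'a::cstar_algebra mat"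
  assumes "Y \<in> carrier_mat n n" "i < n" "j < n"
  shows "(mat_star Y * Y) $$ (i, j) = (\<Sum>k<n. star (Y $$ (k, i)) * Y $$ (k, j))"
  using assms by (auto simp: mat_star_def scalar_prod_def atLeast0LessThan intro!: sum.cong)

text \<open>
  Obtained by applying \<open>T\<close> to \<open>Y\<^sup>* Y\<close>, where \<open>Y\<close> has first row \<open>(1, x, 0, \<dots>, 0)\<close>
  and zeros elsewhere.
\<close>

lemma n_positive_2x2_block:
  fixes T :: "'a::cstar_algebra \<Rightarrow> 'a"
  assumes n: "2 \<le> n" and npos: "n_positive n T" and unital: "T 1 = 1"
  obtains a b :: "nat \<Rightarrow> 'a" where
    "(\<Sum>k<n. star (a k) * a k) = 1"
    "(\<Sum>k<n. star (a k) * b k) = T x"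
    "(\<Sum>k<n. star (b k) * b k) = T (star x * x)"
proof -
  define Y where "Y = mat n n (\<lambda>(i, j). if i = 0 then (if j = 0 then 1 else if j = 1 then x else 0) else 0)"
  have Y: "Y \<in> carrier_mat n n" by (simp add: Y_def)
  then have "map_mat T (mat_star Y * Y) \<in> mat_positive_cone n"
    using npos by (auto simp: n_positive_def mat_positive_cone_def)
  then obtain Z where Z: "Z \<in> carrier_mat n n" and eq: "map_mat T (mat_star Y * Y) = mat_star Z * Z"
    by (auto simp: mat_positive_cone_def)
  have entry: "(\<Sum>k<n. star (Z $$ (k, i)) * Z $$ (k, j)) = T (star (Y $$ (0, i)) * Y $$ (0, j))"
    if ij: "i < n" "j < n" for i j
  proof -
    have "star (Y $$ (k, i)) * Y $$ (k, j) = (if k = 0 then star (Y $$ (0, i)) * Y $$ (0, j) else 0)"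
      if "k < n" for k
      using ij that by (simp add: Y_def)
    then have "(mat_star Y * Y) $$ (i, j) = (\<Sum>k<n. if k = 0 then star (Y $$ (0, i)) * Y $$ (0, j) else 0)"
      unfolding mat_star_mult_index[OF Y ij] by (intro sum.cong) auto
    also have "\<dots> = star (Y $$ (0, i)) * Y $$ (0, j)" using n by simp
    finally have "map_mat T (mat_star Y * Y) $$ (i, j) = T (star (Y $$ (0, i)) * Y $$ (0, j))"
      using Y ij by (simp add: mat_star_def)
    then show ?thesis unfolding eq mat_star_mult_index[OF Z ij] .
  qed
  show thesis
    by (rule that[of "\<lambda>k. Z $$ (k, 0)" "\<lambda>k. Z $$ (k, 1)"])
      (use n entry[of 0 0] entry[of 0 1] entry[of 1 1] in \<open>simp_all add: Y_def unital\<close>)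
qed

text \<open>Schur complement: for the columns \<open>a\<close>, \<open>b\<close> with
  \<open><a, a> = 1\<close>, the component of \<open>b\<close> orthogonal to \<open>a\<close> is
  \<open>b - a T x\<close>, and its inner square is
  \<open>T (star x * x) - star (T x) * T x\<close>.\<close>

lemma n_positive_schwarz:
  fixes T :: "'a::cstar_algebra \<Rightarrow> 'a"
  assumes fd: "finite_dimensional TYPE('a)"
    and n: "2 \<le> n" and npos: "n_positive n T" and unital: "T 1 = 1"
  shows "T (star x * x) - star (T x) * T x \<in> positive_cone" "T (star x * x) \<in> positive_cone"
proof -
  obtain a b :: "nat \<Rightarrow> 'a" where ab: "(\<Sum>k<n. star (a k) * a k) = 1"
    "(\<Sum>k<n. star (a k) * b k) = T x" "(\<Sum>k<n. star (b k) * b k) = T (star x * x)"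
    using n_positive_2x2_block[OF n npos unital] .
  have ba: "(\<Sum>k<n. star (b k) * a k) = star (T x)"
    by (simp add: star_sum star_mult star_star flip: ab(2))
  have "(\<Sum>k<n. star (b k - a k * T x) * (b k - a k * T x))
      = (\<Sum>k<n. star (b k) * b k) - (\<Sum>k<n. star (b k) * a k) * T x
        - star (T x) * (\<Sum>k<n. star (a k) * b k) + star (T x) * (\<Sum>k<n. star (a k) * a k) * T x"
    by (simp add: star_mult sum_distrib_left sum_distrib_right algebra_simps sum.distrib sum_subtractf)
  also have "\<dots> = T (star x * x) - star (T x) * T x" by (simp add: ab ba)
  finally show "T (star x * x) - star (T x) * T x \<in> positive_cone"
    by (rule subst) (intro positive_cone_sum[OF fd] star_self_mult_in_positive_cone)
  show "T (star x * x) \<in> positive_cone"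
    unfolding ab(3)[symmetric] by (intro positive_cone_sum[OF fd] star_self_mult_in_positive_cone)
qed

theorem theorem4p1:
  fixes T :: "'a::cstar_algebra \<Rightarrow> 'a"
  assumes "finite_dimensional TYPE('a)"
    and "clinear T"
    and "T 1 = 1"
    and "op_spectrum T \<subseteq> {z. cmod z = 1}"
  shows "(positive_operator T \<longrightarrow>
            bij T \<and> positive_operator (inv_into UNIV T) \<and> jordan_automorphism T) \<and>
         (schwarz_operator T \<longrightarrow> cstar_automorphism T) \<and>
         (\<forall>n::nat. n \<ge> 2 \<longrightarrow> n_positive n T \<longrightarrow> cstar_automorphism T)"
proof (intro conjI impI allI)
  note fd = assms(1) and T = assms(2) and unital = assms(3) and sp = assms(4)
  show bij: "bij T"
    by (rule bij_if_0_notin_op_spectrum) (use sp in auto)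
  have reflects: "y \<in> positive_cone" if "positive_operator T" "T y \<in> positive_cone" for y
    using positive_if_image_positive[OF fd that(1) unital sp that(2)] .
  show "positive_operator (inv_into UNIV T)" if pos: "positive_operator T"
  proof -
    let ?I = "inv_into UNIV T"
    have T_inv: "T (?I x) = x" and inv_T: "?I (T x) = x" for x
      using bij by (simp_all add: bij_is_surj surj_f_inv_f bij_is_inj)
    have "clinear ?I"
      unfolding clinear_iff
    proof (intro conjI allI)
      fix x y c
      show "?I (x + y) = ?I x + ?I y"
        using inv_T[of "?I x + ?I y"] by (simp add: clinear_add[OF T] T_inv)
      show "?I (c *\<^sub>C x) = c *\<^sub>C ?I x"
        using inv_T[of "c *\<^sub>C ?I x"] by (simp add: clinear_scaleC[OF T] T_inv)
    qed
    then show ?thesis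
      using reflects[OF pos] T_inv by (auto simp: positive_operator_def)
  qed
  show "jordan_automorphism T" if pos: "positive_operator T"
    using order_automorphism_jordan[OF fd pos unital bij reflects[OF pos]] .
  show "cstar_automorphism T" if schwarz: "schwarz_operator T"
  proof -
    have pos: "positive_operator T" by (rule schwarz_positive[OF fd schwarz unital])
    have "bounded_linear T"
      using schwarz bounded_linear_if_bounded_clinear by (auto simp: schwarz_operator_def)
    then show ?thesis
      using schwarz_order_automorphism[OF fd pos unital bij reflects[OF pos], of "onorm T"]
        schwarz onorm_pos_le
      by (auto simp: schwarz_operator_def cstar_le_def)
  qed
  show "cstar_automorphism T" if "2 \<le> n" "n_positive n T" for n :: nat
  proof -
    note npos = n_positive_schwarz[OF fd that unital]
    have pos: "positive_operator T"
      using npos(2) T by (auto simp: positive_operator_def positive_cone_def)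
    show ?thesis
      using schwarz_order_automorphism[OF fd pos unital bij reflects[OF pos], of 1] npos(1) by simp
  qed
qed

end
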